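(* Let $K(h)\in\mathrm{GL}_2(\mathbb{C}[h])$. Then $K(h)\in\mathcal S$ if and only if $K(h)$ is $\sigma^{-1}$-similar to a matrix of the form $$\mathrm{diag}(\beta_1,\beta_2)\,E(v_1)E(v_2)\cdots E(v_m),\qquad \text{where } \beta_1,\beta_2\in\mathbb{C}^*,\ m\ge 1,\ v_i(h)\in\mathbb{C}[h]\setminus\mathbb{C}\ (1\le i\le m).$$
   Context: $\mathbb{C}[h]$ is the polynomial ring in one variable $h$, $\mathbb{C}^*=\mathbb{C}\setminus\{0\}$, and $\mathrm{GL}_2(\mathbb{C}[h])$ is the group of invertible $2\times2$ matrices over $\mathbb{C}[h]$. For $u(h)\in\mathbb{C}[h]$ put $E(u)=\begin{pmatrix}u(h)&1\\-1&0\end{pmatrix}$. Two matrices $A(h),B(h)\in\mathrm{Mat}_2(\mathbb{C}[h])$ are $\sigma^{-1}$-similar if $B(h)=P(h)^{-1}A(h)P(h+1)$ for some $P(h)\in\mathrm{GL}_2(\mathbb{C}[h])$; the $\sigma^{-1}$-orbit of $A$ is $\mathrm{Orb}_{\sigma^{-1}}(A)=\{P(h)^{-1}A(h)P(h+1): P(h)\in\mathrm{GL}_2(\mathbb{C}[h])\}$. The set $\mathcal S$ is $$\mathcal S=\mathrm{GL}_2(\mathbb{C}[h])\setminus\bigcup_{a,b\in\mathbb{C}^*}\mathrm{Orb}_{\sigma^{-1}}(\mathrm{diag}(a,b)).$$ *)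

theory Defs
  imports "HOL-Analysis.Analysis" "HOL-Computational_Algebra.Polynomial"
begin

type_synonym pmat2 = "complex poly ^ 2 ^ 2"

definition GL2 :: "pmat2 set" where
  "GL2 = {P. invertible P}"

definition diag2 :: "complex \<Rightarrow> complex \<Rightarrow> pmat2" where
  "diag2 a b = vector [vector [[:a:], 0], vector [0, [:b:]]]"

definition Emat :: "complex poly \<Rightarrow> pmat2" where
  "Emat u = vector [vector [u, 1], vector [-1, 0]]"

(* The matrix product on this type is ** ; the class multiplication * is entrywise. *)
definition Eprod :: "complex poly list \<Rightarrow> pmat2" where
  "Eprod vs = foldr (\<lambda>v M. Emat v ** M) vs (mat 1)"

(* P(h) \<mapsto> P(h+1): substitution of the polynomial h + 1 = [:1, 1:] in every entry. *)
definition shift_mat :: "pmat2 \<Rightarrow> pmat2" where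
  "shift_mat P = (\<chi> i j. pcompose (P $ i $ j) [:1, 1:])"

definition sigma_inv_similar :: "pmat2 \<Rightarrow> pmat2 \<Rightarrow> bool" where
  "sigma_inv_similar A B \<longleftrightarrow> (\<exists>P \<in> GL2. B = matrix_inv P ** A ** shift_mat P)"

definition sigma_inv_orbit :: "pmat2 \<Rightarrow> pmat2 set" where
  "sigma_inv_orbit A = {matrix_inv P ** A ** shift_mat P | P. P \<in> GL2}"

definition S_set :: "pmat2 set" where
  "S_set = GL2 - (\<Union>a \<in> UNIV - {0}. \<Union>b \<in> UNIV - {0}. sigma_inv_orbit (diag2 a b))"

end

theory Submission
  imports Defs "HOL-Computational_Algebra.Fundamental_Theorem_Algebra"
begin

text \<open>
  \<^bold>\<open>Reduction.\<close> The Euclidean algorithm on the bottom row writes every matrix of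
  \<^term>\<open>GL2\<close> as a constant diagonal matrix times a word \<^term>\<open>Eprod us\<close>
  (\<open>GL2_imp_diag2_Eprod\<close>). Conjugating by a prefix of the word moves that prefix, with its
  argument shifted, to the right end, so the word may be rotated cyclically; constant diagonal
  factors can always be brought back to the left at the price of rescaling the letters. Hence a
  constant letter \<open>c\<close> may be assumed to stand in front. There it can be removed: for
  \<open>c \<noteq> 0\<close> the product \<open>E(c)E(z)\<close> is a lower triangular matrix with constant
  diagonal times a single \<open>E(z')\<close>, and \<open>E(0)E(z)\<close> is itself such a
  triangular matrix. A triangular factor in front is conjugated to the right end, where the last
  letter absorbs it. Each such step shortens the word, so it ends either with a nonempty word all of
  whose letters are nonconstant, or with the empty word, i.e. a diagonal matrix
  (\<open>similar_to_nonconstant_word_or_diag\<close>). If only one constant letter is left, the matrix is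
  constant, and an eigenvector makes it triangular. A triangular matrix without letters behind it is
  similar to its diagonal because the operator
  \<open>p(h) \<mapsto> a p(h) - b p(h+1)\<close> is surjective on polynomials
  (\<open>twisted_difference_surj\<close>).

  \<^bold>\<open>The two outcomes exclude each other.\<close> If \<open>P\<close> conjugates
  \<open>diag(a,b)\<close> to \<open>M = diag(\<beta>\<^sub>1,\<beta>\<^sub>2) E(v\<^sub>1)...E(v\<^sub>m)\<close>,
  then multiplying a row of \<open>P\<close> by \<open>M\<close> only shifts and rescales that row, so
  the degrees of its two entries are unchanged. But nonconstant letters strictly raise the degree of
  the first entry if it is at least that of the second (\<open>Eprod_raises_dominant_first\<close>),
  and otherwise the same argument read backwards shows that the degree of the second entry strictly
  drops (\<open>Eprod_lowers_dominant_second\<close>).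
\<close>

section \<open>Two-by-two matrices in coordinates\<close>

definition mat2 :: "'a \<Rightarrow> 'a \<Rightarrow> 'a \<Rightarrow> 'a \<Rightarrow> 'a::zero ^ 2 ^ 2" where
  "mat2 a b c d = vector [vector [a, b], vector [c, d]]"

lemma mat2_nth [simp]:
  "mat2 a b c d $ 1 $ 1 = a" "mat2 a b c d $ 1 $ 2 = b"
  "mat2 a b c d $ 2 $ 1 = c" "mat2 a b c d $ 2 $ 2 = d"
  by (simp_all add: mat2_def)

lemma mat2_eq_iff [simp]:
  "mat2 a b c d = mat2 a' b' c' d' \<longleftrightarrow> a = a' \<and> b = b' \<and> c = c' \<and> d = d'"
  by (metis mat2_nth)

lemma mat2_cases:
  obtains a b c d where "A = mat2 a b c d"
proof
  show "A = mat2 (A $ 1 $ 1) (A $ 1 $ 2) (A $ 2 $ 1) (A $ 2 $ 2)"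
    by (simp add: vec_eq_iff forall_2)
qed

lemma mat2_mult [simp]:
  fixes a :: "'a::semiring_1"
  shows "mat2 a b c d ** mat2 a' b' c' d' =
    mat2 (a * a' + b * c') (a * b' + b * d') (c * a' + d * c') (c * b' + d * d')"
  by (simp add: vec_eq_iff forall_2 matrix_matrix_mult_def sum_2)

lemma mat_1_eq_mat2: "mat 1 = mat2 1 0 0 1"
  by (simp add: vec_eq_iff forall_2 mat_def)

lemma diag2_eq_mat2: "diag2 a b = mat2 [:a:] 0 0 [:b:]"
  by (simp add: diag2_def mat2_def)

lemma Emat_eq_mat2: "Emat u = mat2 u 1 (-1) 0"
  by (simp add: Emat_def mat2_def)

lemma shift_mat2 [simp]:
  "shift_mat (mat2 a b c d) = mat2 (a \<circ>\<^sub>p [:1, 1:]) (b \<circ>\<^sub>p [:1, 1:]) (c \<circ>\<^sub>p [:1, 1:]) (d \<circ>\<^sub>p [:1, 1:])"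
  by (simp add: shift_mat_def vec_eq_iff forall_2)

lemmas mat2_forms = diag2_eq_mat2 Emat_eq_mat2 mat_1_eq_mat2

lemma invertible_mat2I:
  fixes a :: "'a::comm_ring_1"
  assumes "(a * d - b * c) * e = 1"
  shows "invertible (mat2 a b c d)"
  unfolding invertible_def
proof (intro exI conjI)
  show "mat2 a b c d ** mat2 (d * e) (- b * e) (- c * e) (a * e) = mat 1"
    using assms by (simp add: mat_1_eq_mat2 algebra_simps)
  show "mat2 (d * e) (- b * e) (- c * e) (a * e) ** mat2 a b c d = mat 1"
    using assms by (simp add: mat_1_eq_mat2 algebra_simps)
qed

lemma invertible_mat2_imp_det_unit:
  fixes a :: "'a::comm_ring_1"
  assumes "invertible (mat2 a b c d)"
  shows "(a * d - b * c) dvd 1"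
proof -
  obtain B where B: "mat2 a b c d ** B = mat 1"
    using assms by (auto simp: invertible_def)
  have "det (mat2 a b c d) * det B = 1"
    by (simp flip: det_mul add: B)
  then show ?thesis
    by (metis det_2 dvd_triv_left mat2_nth)
qed

lemma GL2_mult: "A \<in> GL2 \<Longrightarrow> B \<in> GL2 \<Longrightarrow> A ** B \<in> GL2"
  by (simp add: GL2_def invertible_mult)

lemma diag2_in_GL2: "a \<noteq> 0 \<Longrightarrow> b \<noteq> 0 \<Longrightarrow> diag2 a b \<in> GL2"
  by (simp add: GL2_def diag2_eq_mat2 invertible_mat2I[where e = "[:1 / (a * b):]"] one_pCons)

lemma Emat_in_GL2: "Emat u \<in> GL2"
  by (simp add: GL2_def Emat_eq_mat2 invertible_mat2I[where e = 1])

lemma Eprod_Nil [simp]: "Eprod [] = mat 1"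
  and Eprod_Cons [simp]: "Eprod (u # us) = Emat u ** Eprod us"
  by (simp_all add: Eprod_def)

lemma Eprod_append: "Eprod (us @ vs) = Eprod us ** Eprod vs"
  by (induction us) (simp_all add: matrix_mul_assoc)

lemma Eprod_in_GL2: "Eprod us \<in> GL2"
proof (induction us)
  case Nil
  then show ?case by (simp add: GL2_def mat_1_eq_mat2 invertible_mat2I[where e = 1])
qed (simp add: GL2_mult Emat_in_GL2)

section \<open>The similarity relation\<close>

lemma shift_mat_mult: "shift_mat (A ** B) = shift_mat A ** shift_mat B"
  by (cases A rule: mat2_cases, cases B rule: mat2_cases)
     (simp add: pcompose_add pcompose_mult)

lemma shift_mat_one [simp]: "shift_mat (mat 1) = mat 1"
  by (simp add: mat_1_eq_mat2 pcompose_1)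

lemma matrix_inv_GL2:
  assumes "P \<in> GL2"
  shows "P ** matrix_inv P = mat 1" "matrix_inv P ** P = mat 1"
  using assms someI_ex[of "\<lambda>B. P ** B = mat 1 \<and> B ** P = mat 1"]
  by (auto simp: GL2_def invertible_def matrix_inv_def)

lemma sigma_inv_similar_iff:
  "sigma_inv_similar A B \<longleftrightarrow> (\<exists>P\<in>GL2. P ** B = A ** shift_mat P)"
  unfolding sigma_inv_similar_def
  by (metis matrix_inv_GL2 matrix_mul_assoc matrix_mul_lid)

lemma sigma_inv_similarI:
  assumes "P \<in> GL2" "P ** B = A ** shift_mat P"
  shows "sigma_inv_similar A B"
  using assms sigma_inv_similar_iff by blast

lemma sigma_inv_similar_refl: "sigma_inv_similar A A"
proof (rule sigma_inv_similarI)
  show "mat 1 \<in> GL2" using Eprod_in_GL2[of "[]"] by simp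
qed simp

lemma sigma_inv_similar_sym:
  assumes "sigma_inv_similar A B"
  shows "sigma_inv_similar B A"
proof -
  obtain P where P: "P \<in> GL2" "P ** B = A ** shift_mat P"
    using assms sigma_inv_similar_iff by blast
  let ?Q = "matrix_inv P"
  note PQ = matrix_inv_GL2[OF P(1)]
  have S: "shift_mat P ** shift_mat ?Q = mat 1"
    by (simp flip: shift_mat_mult add: PQ)
  show ?thesis
  proof (rule sigma_inv_similarI)
    show "?Q \<in> GL2" using PQ by (auto simp: GL2_def invertible_def)
    have "?Q ** A = ?Q ** (A ** shift_mat P) ** shift_mat ?Q"
      by (metis S matrix_mul_assoc matrix_mul_rid)
    also have "\<dots> = B ** shift_mat ?Q"
      by (metis P(2) PQ(2) matrix_mul_assoc matrix_mul_lid)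
    finally show "?Q ** A = B ** shift_mat ?Q" .
  qed
qed

lemma sigma_inv_similar_trans [trans]:
  assumes "sigma_inv_similar A B" "sigma_inv_similar B C"
  shows "sigma_inv_similar A C"
proof -
  obtain P Q where P: "P \<in> GL2" "P ** B = A ** shift_mat P"
    and Q: "Q \<in> GL2" "Q ** C = B ** shift_mat Q"
    using assms sigma_inv_similar_iff by meson
  show ?thesis
  proof (rule sigma_inv_similarI)
    show "P ** Q \<in> GL2" using P Q GL2_mult by blast
    show "P ** Q ** C = A ** shift_mat (P ** Q)"
      by (metis P(2) Q(2) matrix_mul_assoc shift_mat_mult)
  qed
qed

text \<open>
  This is what permits cyclic rotation of a product, up to a shift of the factor that is moved.
\<close>
lemma sigma_inv_similar_rotate:
  "A \<in> GL2 \<Longrightarrow> sigma_inv_similar (A ** B) (B ** shift_mat A)"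
  by (rule sigma_inv_similarI[of A]) (simp_all add: matrix_mul_assoc)

section \<open>Triangular matrices with constant diagonal\<close>

definition ltri :: "complex \<Rightarrow> complex \<Rightarrow> complex poly \<Rightarrow> pmat2" where
  "ltri a b l = mat2 [:a:] 0 l [:b:]"

lemma ltri_in_GL2: "a \<noteq> 0 \<Longrightarrow> b \<noteq> 0 \<Longrightarrow> ltri a b l \<in> GL2"
  by (simp add: GL2_def ltri_def invertible_mat2I[where e = "[:1 / (a * b):]"] one_pCons)

lemma diag2_eq_ltri: "diag2 a b = ltri a b 0"
  by (simp add: diag2_eq_mat2 ltri_def)

lemma ltri_mult: "ltri a b l ** ltri a' b' l' = ltri (a * a') (b * b') (smult a' l + smult b l')"
  by (simp add: ltri_def)

lemma shift_ltri: "shift_mat (ltri a b l) = ltri a b (l \<circ>\<^sub>p [:1, 1:])"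
  by (simp add: ltri_def)

text \<open>
  The operator \<open>p(h) \<mapsto> a p(h) - b p(h+1)\<close> preserves degrees if
  \<open>a \<noteq> b\<close>; if \<open>a = b\<close> it lowers the degree of a nonconstant polynomial by
  exactly one, the new top coefficient coming from the linear binomial term. In both cases every
  degree is attained, so the top coefficient of a right-hand side can be cancelled.
\<close>
lemma twisted_difference_surj:
  fixes a b :: complex
  assumes "a \<noteq> 0"
  shows "\<exists>p. smult a p - smult b (p \<circ>\<^sub>p [:1, 1:]) = l"
proof -
  define L where "L p = smult a p - smult b (p \<circ>\<^sub>p [:1, 1:])" for p
  have L_add: "L (p + q) = L p + L q" for p q
    by (simp add: L_def pcompose_add smult_add_right)
  have L_smult: "L (smult c p) = smult c (L p)" for c p
    by (simp add: L_def pcompose_smult smult_diff_right mult.commute)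
  have coeff_L: "coeff (L (monom 1 m)) i = (if i = m then a else 0) - b * of_nat (m choose i)" for m i
  proof -
    have "monom 1 m \<circ>\<^sub>p [:1, 1:] = [:1, 1 :: complex:] ^ m"
      by (induction m) (simp_all add: monom_0 monom_Suc pcompose_pCons pcompose_1 flip: one_pCons)
    moreover have "coeff ([:1, 1 :: complex:] ^ m) i = of_nat (m choose i)"
    proof (cases "i \<le> m")
      case False
      then have "degree ([:1, 1 :: complex:] ^ m) < i"
        using degree_power_le[of "[:1, 1 :: complex:]" m] by simp
      then show ?thesis using False by (simp add: coeff_eq_0)
    qed (simp add: coeff_linear_poly_power)
    ultimately show ?thesis by (auto simp: L_def)
  qed
  have top: "\<exists>p. coeff (L p) n \<noteq> 0 \<and> (\<forall>i>n. coeff (L p) i = 0)" for n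
  proof (cases "a = b")
    case True
    have "coeff (L (monom 1 (Suc n))) n = - (a * of_nat (Suc n))"
      using True by (simp add: coeff_L del: of_nat_Suc)
    moreover have "coeff (L (monom 1 (Suc n))) i = 0" if "i > n" for i
      using True that by (cases "i = Suc n") (simp_all add: coeff_L binomial_eq_0 del: binomial_Suc_Suc)
    ultimately show ?thesis
      using assms by (metis mult_eq_0_iff neg_equal_0_iff_equal of_nat_eq_0_iff nat.distinct(1))
  next
    case False
    then show ?thesis
      by (intro exI[of _ "monom 1 n"]) (auto simp: coeff_L binomial_eq_0)
  qed
  have "\<exists>p. L p = l" if "\<forall>i\<ge>n. coeff l i = 0" for n l
    using that
  proof (induction n arbitrary: l)
    case 0
    then have "l = 0" by (simp add: poly_eq_iff)
    then show ?case by (intro exI[of _ 0]) (simp add: L_def)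
  next
    case (Suc n)
    obtain q where q: "coeff (L q) n \<noteq> 0" "\<forall>i>n. coeff (L q) i = 0"
      using top by blast
    define c where "c = coeff l n / coeff (L q) n"
    have "\<forall>i\<ge>n. coeff (l - smult c (L q)) i = 0"
    proof (intro allI impI)
      fix i assume "n \<le> i"
      then consider "i = n" | "i \<ge> Suc n" by linarith
      then show "coeff (l - smult c (L q)) i = 0"
        by cases (use Suc.prems q in \<open>auto simp: c_def\<close>)
    qed
    then obtain p where "L p = l - smult c (L q)"
      using Suc.IH by blast
    then have "L (p + smult c q) = l" by (simp add: L_add L_smult)
    then show ?case by blast
  qed
  from this[of "Suc (degree l)" l] show ?thesis
    by (auto simp: L_def coeff_eq_0)
qed

lemma ltri_similar_diag2:
  assumes "a \<noteq> 0"
  shows "sigma_inv_similar (ltri a b l) (diag2 a b)"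
proof -
  obtain p where p: "smult a p - smult b (p \<circ>\<^sub>p [:1, 1:]) = l"
    using twisted_difference_surj[OF assms] by blast
  show ?thesis
  proof (rule sigma_inv_similarI)
    show "ltri 1 1 p \<in> GL2" by (simp add: ltri_in_GL2)
    show "ltri 1 1 p ** diag2 a b = ltri a b l ** shift_mat (ltri 1 1 p)"
      by (simp add: diag2_eq_ltri shift_ltri ltri_mult flip: p)
  qed
qed

text \<open>
  Since \<open>E(w)\<close> is \<open>E(0)\<close> times the lower unitriangular matrix with entry
  \<open>w\<close>, a lower triangular factor on its right only changes \<open>w\<close> and the diagonal.
\<close>
lemma Emat_ltri:
  assumes "b \<noteq> 0"
  shows "Emat w ** ltri a b l = diag2 b a ** Emat (smult (a / b) w + smult (1 / b) l)"
  using assms by (simp add: mat2_forms ltri_def smult_add_right)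

lemma Eprod_ltri:
  assumes "a \<noteq> 0" "b \<noteq> 0" "us \<noteq> [] \<or> l = 0"
  shows "\<exists>\<beta>1 \<beta>2 us'. \<beta>1 \<noteq> 0 \<and> \<beta>2 \<noteq> 0 \<and> length us' = length us \<and>
    Eprod us ** ltri a b l = diag2 \<beta>1 \<beta>2 ** Eprod us'"
  using assms(3)
proof (induction us)
  case Nil
  then show ?case
    using assms by (intro exI[of _ a] exI[of _ b] exI[of _ "[]"]) (simp add: diag2_eq_ltri)
next
  case (Cons u us)
  have "\<exists>\<beta>1 \<beta>2 l' us'. \<beta>1 \<noteq> 0 \<and> \<beta>2 \<noteq> 0 \<and> length us' = length us \<and>
    Eprod us ** ltri a b l = ltri \<beta>1 \<beta>2 l' ** Eprod us'"
    using Cons.IH assms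
    by (cases "us = []") (force, metis diag2_eq_ltri)
  then obtain \<beta>1 \<beta>2 l' us' where nz: "\<beta>1 \<noteq> 0" "\<beta>2 \<noteq> 0" and len: "length us' = length us"
    and eq: "Eprod us ** ltri a b l = ltri \<beta>1 \<beta>2 l' ** Eprod us'" by blast
  let ?u = "smult (\<beta>1 / \<beta>2) u + smult (1 / \<beta>2) l'"
  have "Eprod (u # us) ** ltri a b l = Emat u ** ltri \<beta>1 \<beta>2 l' ** Eprod us'"
    by (metis Eprod_Cons eq matrix_mul_assoc)
  also have "\<dots> = diag2 \<beta>2 \<beta>1 ** Eprod (?u # us')"
    by (simp add: Emat_ltri nz(2) matrix_mul_assoc)
  finally show ?case
    using nz len by (metis length_Cons)
qed

section \<open>The Euclidean algorithm\<close>

text \<open>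
  Splitting off the last letter \<open>E(u)\<close> replaces the bottom row \<open>(p, q)\<close> by
  \<open>(q, q u - p)\<close>; with \<open>u = p div q\<close> this is a step of the Euclidean
  algorithm.
\<close>
lemma GL2_imp_diag2_Eprod:
  assumes "K \<in> GL2"
  shows "\<exists>\<beta>1 \<beta>2 us. \<beta>1 \<noteq> 0 \<and> \<beta>2 \<noteq> 0 \<and> K = diag2 \<beta>1 \<beta>2 ** Eprod us"
  using assms
proof (induction "if K $ 2 $ 2 = 0 then 0 else Suc (degree (K $ 2 $ 2))" arbitrary: K rule: less_induct)
  case less
  obtain x y p q where K: "K = mat2 x y p q" by (rule mat2_cases)
  show ?case
  proof (cases "q = 0")
    case True
    have "y * p dvd 1"
      using invertible_mat2_imp_det_unit[of x y p q] less.prems K True by (simp add: GL2_def)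
    then have "y dvd 1" "p dvd 1"
      using dvd_mult_left dvd_mult_right by blast+
    then obtain c d where y: "y = [:c:]" "c \<noteq> 0" and p: "p = [:d:]" "d \<noteq> 0"
      unfolding is_unit_poly_iff by (metis dvd_0_left_iff zero_neq_one)
    have "K = diag2 c (- d) ** Eprod [smult (1 / c) x]"
      using True y p K by (simp add: mat2_forms)
    then show ?thesis using y p by (metis neg_equal_0_iff_equal)
  next
    case False
    define u where "u = p div q"
    define K' where "K' = mat2 y (y * u - x) q (q * u - p)"
    have K_eq: "K = K' ** Emat u"
      by (simp add: K K'_def Emat_eq_mat2)
    have "K' = K ** mat2 0 (-1) 1 u"
      by (simp add: K K'_def)
    moreover have "mat2 0 (-1) 1 u \<in> GL2"
      by (simp add: GL2_def invertible_mat2I[where e = 1])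
    ultimately have K': "K' \<in> GL2"
      using less.prems GL2_mult by simp
    have "q * u - p = - (p mod q)"
      by (simp add: u_def minus_mod_eq_mult_div[symmetric])
    then have "q * u - p = 0 \<or> degree (q * u - p) < degree q"
      using False degree_mod_less[of q p] by auto
    then have "(if K' $ 2 $ 2 = 0 then 0 else Suc (degree (K' $ 2 $ 2))) <
        (if K $ 2 $ 2 = 0 then 0 else Suc (degree (K $ 2 $ 2)))"
      using False by (auto simp: K K'_def)
    then obtain \<beta>1 \<beta>2 us where "\<beta>1 \<noteq> 0" "\<beta>2 \<noteq> 0" "K' = diag2 \<beta>1 \<beta>2 ** Eprod us"
      using less.hyps[OF _ K'] by blast
    moreover from this have "K = diag2 \<beta>1 \<beta>2 ** Eprod (us @ [u])"
      by (simp add: K_eq Eprod_append matrix_mul_assoc)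
    ultimately show ?thesis by blast
  qed
qed

section \<open>Removing constant letters\<close>

text \<open>
  A word behind a triangular factor: conjugation carries the factor to the right end of the word,
  which absorbs it.
\<close>
lemma ltri_Eprod_similar:
  assumes "a \<noteq> 0" "b \<noteq> 0"
  shows "\<exists>\<beta>1 \<beta>2 us'. \<beta>1 \<noteq> 0 \<and> \<beta>2 \<noteq> 0 \<and> length us' = length us \<and>
    sigma_inv_similar (ltri a b l ** Eprod us) (diag2 \<beta>1 \<beta>2 ** Eprod us')"
proof (cases us)
  case Nil
  then show ?thesis
    using assms ltri_similar_diag2[of a b l]
    by (intro exI[of _ a] exI[of _ b] exI[of _ "[]"]) simp
next
  case (Cons u ws)
  have "sigma_inv_similar (ltri a b l ** Eprod us) (Eprod us ** ltri a b (l \<circ>\<^sub>p [:1, 1:]))"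
    using sigma_inv_similar_rotate[OF ltri_in_GL2[OF assms]] by (simp add: shift_ltri)
  then show ?thesis
    using Eprod_ltri[OF assms, of us "l \<circ>\<^sub>p [:1, 1:]"] Cons by (metis list.distinct(1))
qed

text \<open>
  A constant matrix has an eigenvector; taking it as second column of a constant base change makes
  the matrix lower triangular. Here the eigenvector is \<open>(t, - b)\<close> for an eigenvalue
  \<open>t\<close>.
\<close>
lemma diag2_Emat_const_similar:
  assumes "a \<noteq> 0" "b \<noteq> 0"
  shows "\<exists>\<beta>1 \<beta>2. \<beta>1 \<noteq> 0 \<and> \<beta>2 \<noteq> 0 \<and>
    sigma_inv_similar (diag2 a b ** Emat [:c:]) (diag2 \<beta>1 \<beta>2)"
proof -
  have "\<not> constant (poly [:a * b, - a * c, 1:])"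
    by (simp add: constant_degree)
  then obtain t where "poly [:a * b, - a * c, 1:] t = 0"
    using fundamental_theorem_of_algebra by blast
  then have t: "(a * c - t) * t = a * b"
    by (simp add: algebra_simps)
  then have nz: "t \<noteq> 0" "a * c - t \<noteq> 0"
    using assms by auto
  have "sigma_inv_similar (diag2 a b ** Emat [:c:]) (ltri (a * c - t) t 1)"
  proof (rule sigma_inv_similarI)
    show "mat2 1 [:t:] 0 [:-b:] \<in> GL2"
      using assms by (simp add: GL2_def invertible_mat2I[where e = "[:-1 / b:]"] one_pCons)
    show "mat2 1 [:t:] 0 [:-b:] ** ltri (a * c - t) t 1 =
        diag2 a b ** Emat [:c:] ** shift_mat (mat2 1 [:t:] 0 [:-b:])"
      using t by (simp add: mat2_forms ltri_def pcompose_1 one_pCons algebra_simps)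
  qed
  also have "sigma_inv_similar \<dots> (diag2 (a * c - t) t)"
    by (rule ltri_similar_diag2) fact
  finally show ?thesis using nz by blast
qed

text \<open>
  For \<open>c \<noteq> 0\<close> the matrix \<open>E(c)E(z)\<close> equals
  \<open>ltri c (1/c) (-1) E(z - 1/c)\<close>, and \<open>E(0)E(z)\<close> is lower triangular, so
  the word loses one letter or two.
\<close>
lemma leading_constant_shorten:
  assumes "a \<noteq> 0" "b \<noteq> 0"
  shows "\<exists>\<beta>1 \<beta>2 us'. \<beta>1 \<noteq> 0 \<and> \<beta>2 \<noteq> 0 \<and> length us' < Suc (length us) \<and>
    sigma_inv_similar (diag2 a b ** Eprod ([:c:] # us)) (diag2 \<beta>1 \<beta>2 ** Eprod us')"
proof (cases us)
  case Nil
  then show ?thesis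
    using diag2_Emat_const_similar[OF assms, of c] by (metis Eprod_Cons Eprod_Nil length_Cons
        less_Suc_eq_0_disj list.size(3) matrix_mul_rid)
next
  case (Cons z zs)
  have "\<exists>a' b' l ws. a' \<noteq> 0 \<and> b' \<noteq> 0 \<and> length ws \<le> length us \<and>
    diag2 a b ** Eprod ([:c:] # us) = ltri a' b' l ** Eprod ws"
  proof (cases "c = 0")
    case True
    have "diag2 a b ** Emat [:c:] ** Emat z = ltri (- a) (- b) (smult (- b) z)"
      using True by (simp add: mat2_forms ltri_def)
    then have "diag2 a b ** Eprod ([:c:] # us) = ltri (- a) (- b) (smult (- b) z) ** Eprod zs"
      by (simp add: Cons matrix_mul_assoc)
    then show ?thesis
      using assms Cons by (metis le_SucI length_Cons neg_equal_0_iff_equal order_refl)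
  next
    case False
    have "diag2 a b ** Emat [:c:] ** Emat z = ltri (a * c) (b / c) [:- b:] ** Emat (z - [:1 / c:])"
      using False by (simp add: mat2_forms ltri_def smult_diff_right one_pCons algebra_simps)
    then have "diag2 a b ** Eprod ([:c:] # us) =
        ltri (a * c) (b / c) [:- b:] ** Eprod ((z - [:1 / c:]) # zs)"
      by (simp add: Cons matrix_mul_assoc)
    then show ?thesis
      using assms Cons False by (metis divide_eq_0_iff length_Cons mult_eq_0_iff order_refl)
  qed
  then obtain a' b' l ws where nz: "a' \<noteq> 0" "b' \<noteq> 0" and len: "length ws \<le> length us"
    and eq: "diag2 a b ** Eprod ([:c:] # us) = ltri a' b' l ** Eprod ws" by blast
  then show ?thesis
    using ltri_Eprod_similar[OF nz, of ws l] by (metis le_imp_less_Suc)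
qed

lemma shift_Eprod: "shift_mat (Eprod us) = Eprod (map (\<lambda>u. u \<circ>\<^sub>p [:1, 1:]) us)"
  by (induction us) (simp_all add: shift_mat_mult Emat_eq_mat2 pcompose_1 pcompose_uminus)

text \<open>
  The prefix that is conjugated away contains the diagonal factor as well. That factor therefore
  lands in the middle of the word and is moved back to the left across \<open>ys\<close> and the
  constant letter, which stays constant because it is only rescaled.
\<close>
lemma rotate_constant_to_front:
  assumes "a \<noteq> 0" "b \<noteq> 0"
  shows "\<exists>\<beta>1 \<beta>2 c' us'. \<beta>1 \<noteq> 0 \<and> \<beta>2 \<noteq> 0 \<and> length us' = length xs + length ys \<and>
    sigma_inv_similar (diag2 a b ** Eprod (xs @ [:c:] # ys)) (diag2 \<beta>1 \<beta>2 ** Eprod ([:c':] # us'))"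
proof -
  define xs' where "xs' = map (\<lambda>u. u \<circ>\<^sub>p [:1, 1:]) xs"
  obtain a' b' ys' where nz: "a' \<noteq> 0" "b' \<noteq> 0" and len: "length ys' = length ys"
    and ys: "Eprod ys ** diag2 a b = diag2 a' b' ** Eprod ys'"
    using Eprod_ltri[OF assms, of ys 0] diag2_eq_ltri by metis
  have "sigma_inv_similar (diag2 a b ** Eprod (xs @ [:c:] # ys))
      (Eprod ([:c:] # ys) ** shift_mat (diag2 a b ** Eprod xs))"
    using sigma_inv_similar_rotate[OF GL2_mult[OF diag2_in_GL2[OF assms] Eprod_in_GL2]]
    by (metis Eprod_append matrix_mul_assoc)
  also have "shift_mat (diag2 a b ** Eprod xs) = diag2 a b ** Eprod xs'"
    by (simp add: shift_mat_mult shift_Eprod xs'_def diag2_eq_mat2)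
  also have "Eprod ([:c:] # ys) ** (diag2 a b ** Eprod xs') =
      Emat [:c:] ** (Eprod ys ** diag2 a b) ** Eprod xs'"
    by (simp add: matrix_mul_assoc)
  also have "\<dots> = Emat [:c:] ** ltri a' b' 0 ** Eprod (ys' @ xs')"
    unfolding ys by (simp add: diag2_eq_ltri Eprod_append matrix_mul_assoc)
  also have "\<dots> = diag2 b' a' ** Eprod ([:a' / b' * c:] # ys' @ xs')"
    by (simp add: Emat_ltri nz(2) matrix_mul_assoc)
  finally show ?thesis
    using nz len by (metis add.commute length_append length_map xs'_def)
qed

section \<open>Degrees\<close>

lemma mult_Emat_nth [simp]:
  "(M ** Emat v) $ i $ 1 = M $ i $ 1 * v - M $ i $ 2"
  "(M ** Emat v) $ i $ 2 = M $ i $ 1"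
  by (simp_all add: matrix_matrix_mult_def sum_2 Emat_def)

lemma degree_mult_diff_dominant:
  fixes p q v :: "'a::idom poly"
  assumes "p \<noteq> 0" "degree q \<le> degree p" "degree v > 0"
  shows "degree (p * v - q) = degree p + degree v"
proof -
  have "degree (p * v) = degree p + degree v"
    using assms by (intro degree_mult_eq) auto
  then show ?thesis
    using assms degree_add_eq_left[of "- q" "p * v"] by simp
qed

lemma Eprod_raises_dominant_first:
  assumes "\<forall>v\<in>set vs. degree v > 0" "M $ i $ 1 \<noteq> 0" "degree (M $ i $ 2) \<le> degree (M $ i $ 1)"
  shows "degree ((M ** Eprod vs) $ i $ 1) \<ge> degree (M $ i $ 1) + length vs"
  using assms
proof (induction vs arbitrary: M)
  case (Cons v vs)
  have deg: "degree ((M ** Emat v) $ i $ 1) = degree (M $ i $ 1) + degree v"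
    using Cons.prems by (simp add: degree_mult_diff_dominant)
  then have "degree ((M ** Emat v ** Eprod vs) $ i $ 1) \<ge> degree ((M ** Emat v) $ i $ 1) + length vs"
    using Cons.prems by (intro Cons.IH) (force, force, simp)
  then show ?case
    using deg Cons.prems by (simp add: matrix_mul_assoc)
qed simp

lemma Eprod_lowers_dominant_second:
  assumes "\<forall>v\<in>set vs. degree v > 0" "R = M ** Eprod vs"
    "R $ i $ 2 \<noteq> 0" "degree (R $ i $ 1) \<le> degree (R $ i $ 2)"
  shows "M $ i $ 2 \<noteq> 0 \<and> degree (M $ i $ 1) \<le> degree (M $ i $ 2) \<and>
    degree (M $ i $ 2) \<ge> degree (R $ i $ 2) + length vs"
  using assms
proof (induction vs arbitrary: M)
  case (Cons v vs)
  let ?p = "M $ i $ 1" and ?q = "M $ i $ 2"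
  have IH: "?p \<noteq> 0" "degree (?p * v - ?q) \<le> degree ?p" "degree ?p \<ge> degree (R $ i $ 2) + length vs"
    using Cons.IH[of "M ** Emat v"] Cons.prems by (simp_all add: matrix_mul_assoc)
  \<comment> \<open>\<open>?q = ?p * v - (?p * v - ?q)\<close>, and the subtrahend is dominated by \<open>?p\<close>.\<close>
  have "degree ?q = degree ?p + degree v"
    using degree_mult_diff_dominant[of ?p "?p * v - ?q" v] IH Cons.prems by simp
  moreover have "degree v > 0" using Cons.prems by simp
  ultimately show ?case using IH by auto
qed simp

lemma diag2_not_similar_nonconstant_word:
  assumes "a \<noteq> 0" "b \<noteq> 0" "\<beta>1 \<noteq> 0" "\<beta>2 \<noteq> 0" "vs \<noteq> []" "\<forall>v\<in>set vs. degree v > 0"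
  shows "\<not> sigma_inv_similar (diag2 a b) (diag2 \<beta>1 \<beta>2 ** Eprod vs)"
proof
  assume "sigma_inv_similar (diag2 a b) (diag2 \<beta>1 \<beta>2 ** Eprod vs)"
  then obtain P where P: "P \<in> GL2" "P ** (diag2 \<beta>1 \<beta>2 ** Eprod vs) = diag2 a b ** shift_mat P"
    using sigma_inv_similar_iff by blast
  obtain p q r s where Pm: "P = mat2 p q r s" by (rule mat2_cases)
  have pq: "p \<noteq> 0 \<or> q \<noteq> 0"
    using invertible_mat2_imp_det_unit[of p q r s] P(1) Pm by (auto simp: GL2_def)
  define M where "M = P ** diag2 \<beta>1 \<beta>2"
  define R where "R = M ** Eprod vs"
  have "R = diag2 a b ** shift_mat P"
    by (simp add: R_def M_def P(2) flip: matrix_mul_assoc)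
  then have R: "R $ 1 $ 1 = smult a (p \<circ>\<^sub>p [:1, 1:])" "R $ 1 $ 2 = smult a (q \<circ>\<^sub>p [:1, 1:])"
    by (simp_all add: Pm diag2_eq_mat2)
  have M: "M $ 1 $ 1 = smult \<beta>1 p" "M $ 1 $ 2 = smult \<beta>2 q"
    by (simp_all add: M_def Pm diag2_eq_mat2)
  have len: "length vs > 0" using assms by simp
  show False
  proof (cases "p \<noteq> 0 \<and> degree q \<le> degree p")
    case True
    then show False
      using Eprod_raises_dominant_first[of vs M 1] assms len R M
      by (simp add: degree_pcompose flip: R_def)
  next
    case False
    then have "q \<noteq> 0" "degree p \<le> degree q" using pq by auto
    then show False
      using Eprod_lowers_dominant_second[OF _ R_def, of 1] assms len R M
      by (simp add: degree_pcompose pcompose_eq_0_iff)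
  qed
qed

section \<open>The characterisation\<close>

lemma similar_to_nonconstant_word_or_diag:
  assumes "a \<noteq> 0" "b \<noteq> 0"
  shows "\<exists>\<beta>1 \<beta>2 vs. \<beta>1 \<noteq> 0 \<and> \<beta>2 \<noteq> 0 \<and> (\<forall>v\<in>set vs. degree v > 0) \<and>
    sigma_inv_similar (diag2 a b ** Eprod us) (diag2 \<beta>1 \<beta>2 ** Eprod vs)"
  using assms
proof (induction us arbitrary: a b rule: measure_induct_rule[of length])
  case (less us)
  show ?case
  proof (cases "\<forall>v\<in>set us. degree v > 0")
    case True
    then show ?thesis using less.prems sigma_inv_similar_refl by blast
  next
    case False
    then obtain xs ys c where us: "us = xs @ [:c:] # ys"
      by (metis degree_eq_zeroE gr0I split_list)
    obtain a1 b1 c1 us1 where 1: "a1 \<noteq> 0" "b1 \<noteq> 0" "length us1 = length xs + length ys"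
      "sigma_inv_similar (diag2 a b ** Eprod us) (diag2 a1 b1 ** Eprod ([:c1:] # us1))"
      using rotate_constant_to_front[OF less.prems] us by metis
    obtain a2 b2 us2 where 2: "a2 \<noteq> 0" "b2 \<noteq> 0" "length us2 < Suc (length us1)"
      "sigma_inv_similar (diag2 a1 b1 ** Eprod ([:c1:] # us1)) (diag2 a2 b2 ** Eprod us2)"
      using leading_constant_shorten[OF 1(1,2)] by metis
    have "length us2 < length us" using us 1(3) 2(3) by simp
    from less.IH[OF this 2(1,2)] obtain \<beta>1 \<beta>2 vs
      where 3: "\<beta>1 \<noteq> 0" "\<beta>2 \<noteq> 0" "\<forall>v\<in>set vs. degree v > 0"
        "sigma_inv_similar (diag2 a2 b2 ** Eprod us2) (diag2 \<beta>1 \<beta>2 ** Eprod vs)"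
      by (elim exE conjE)
    note sigma_inv_similar_trans[OF 1(4) sigma_inv_similar_trans[OF 2(4) 3(4)]]
    with 3(1-3) show ?thesis by blast
  qed
qed

lemma nonconstant_iff_degree: "v \<notin> range (\<lambda>c. [:c:]) \<longleftrightarrow> degree v > 0"
  by (metis degree_pCons_0 degree_eq_zeroE gr0I less_irrefl rangeE rangeI)

lemma S_set_iff_not_similar_diag2:
  "K \<in> S_set \<longleftrightarrow> K \<in> GL2 \<and> (\<forall>a b. a \<noteq> 0 \<longrightarrow> b \<noteq> 0 \<longrightarrow> \<not> sigma_inv_similar (diag2 a b) K)"
  by (auto simp: S_set_def sigma_inv_orbit_def sigma_inv_similar_def)

theorem theorem3p10:
  fixes K :: "complex poly ^ 2 ^ 2"
  assumes "K \<in> GL2"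
  shows "K \<in> S_set \<longleftrightarrow>
    (\<exists>\<beta>1 \<beta>2 :: complex. \<exists>vs :: complex poly list.
       \<beta>1 \<noteq> 0 \<and> \<beta>2 \<noteq> 0 \<and> length vs \<ge> 1 \<and>
       (\<forall>v \<in> set vs. v \<notin> range (\<lambda>c :: complex. [:c:])) \<and>
       sigma_inv_similar K (diag2 \<beta>1 \<beta>2 ** Eprod vs))"
    (is "_ \<longleftrightarrow> ?word")
proof
  assume K: "K \<in> S_set"
  obtain a b us where "a \<noteq> 0" "b \<noteq> 0" "K = diag2 a b ** Eprod us"
    using GL2_imp_diag2_Eprod[OF assms] by blast
  then obtain \<beta>1 \<beta>2 vs where nz: "\<beta>1 \<noteq> 0" "\<beta>2 \<noteq> 0" and vs: "\<forall>v\<in>set vs. degree v > 0"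
    and sim: "sigma_inv_similar K (diag2 \<beta>1 \<beta>2 ** Eprod vs)"
    using similar_to_nonconstant_word_or_diag by metis
  have "vs \<noteq> []"
    using K nz sim sigma_inv_similar_sym unfolding S_set_iff_not_similar_diag2
    by (metis Eprod_Nil matrix_mul_rid)
  then have "length vs \<ge> 1"
    by (simp add: Suc_le_eq)
  then show ?word
    using nz vs sim unfolding nonconstant_iff_degree
    by (intro exI[of _ \<beta>1] exI[of _ \<beta>2] exI[of _ vs] conjI)
next
  assume ?word
  then obtain \<beta>1 \<beta>2 vs where nz: "\<beta>1 \<noteq> 0" "\<beta>2 \<noteq> 0" and vs: "vs \<noteq> []" "\<forall>v\<in>set vs. degree v > 0"
    and sim: "sigma_inv_similar K (diag2 \<beta>1 \<beta>2 ** Eprod vs)"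
    unfolding nonconstant_iff_degree by (elim exE conjE) (metis list.size(3) not_one_le_zero)
  then have "\<not> sigma_inv_similar (diag2 a b) K" if "a \<noteq> 0" "b \<noteq> 0" for a b
    using diag2_not_similar_nonconstant_word[OF that nz vs] sigma_inv_similar_trans[OF _ sim] by blast
  then show "K \<in> S_set"
    using assms by (simp add: S_set_iff_not_similar_diag2)
qed

end
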